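(* Let $N\ge 1$, let $\sum_{J\in\mathbb{N}_0^N}c_Jz^J$ be a power series with complex coefficients and let $B^0\subset\mathbb{C}^N$ be its domain of convergence. Then the logarithmic image $G=\lambda\big(B^0\cap(\mathbb{C}\setminus\{0\})^N\big)\subset\mathbb{R}^N$ is the open convex set given by $$G=\Big\{s\in\mathbb{R}^N:\ \limsup_{|J|\to\infty}\Big(\frac{j_1s_1+\dots+j_Ns_N}{j_1+\dots+j_N}+\frac{\log|c_J|}{|J|}\Big)<0\Big\}.$$
   Context: $\mathbb{N}_0=\{0,1,2,\dots\}$. For $J=(j_1,\dots,j_N)\in\mathbb{N}_0^N$: $|J|=j_1+\dots+j_N$ and $z^J=z_1^{j_1}\cdots z_N^{j_N}$. The convention $\log 0=-\infty$ is used, and $\limsup_{|J|\to\infty}a_J$ means $\lim_{k\to\infty}\sup\{a_J:|J|\ge k\}\in[-\infty,+\infty]$. A series of complex numbers $\sum_J a_J$ indexed by $\mathbb{N}_0^N$ is called convergent if it is absolutely convergent, i.e. $\sum_J|a_J|<\infty$. For a power series $\sum_Jc_Jz^J$ let $B$ be the set of all $z\in\mathbb{C}^N$ at which the series converges in this sense; the interior $B^0$ of $B$ is the domain of convergence of the power series. The map $\lambda:(\mathbb{C}\setminus\{0\})^N\to\mathbb{R}^N$ is $\lambda(z)=(\log|z_1|,\dots,\log|z_N|)$. *)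

theory Defs
  imports "HOL-Analysis.Analysis"
begin

definition multideg :: "nat ^ 'n \<Rightarrow> nat" where
  "multideg J = (\<Sum>i\<in>UNIV. J $ i)"

definition multipow :: "complex ^ 'n \<Rightarrow> nat ^ 'n \<Rightarrow> complex" where
  "multipow z J = (\<Prod>i\<in>UNIV. (z $ i) ^ (J $ i))"

definition convergence_set :: "(nat ^ 'n \<Rightarrow> complex) \<Rightarrow> (complex ^ 'n) set" where
  "convergence_set c = {z. (\<lambda>J. norm (c J * multipow z J)) summable_on UNIV}"

definition domain_of_convergence :: "(nat ^ 'n \<Rightarrow> complex) \<Rightarrow> (complex ^ 'n) set" where
  "domain_of_convergence c = interior (convergence_set c)"

(* Only meaningful on the points all of whose coordinates are nonzero: the library has ln 0 = 0. *)
definition log_map :: "complex ^ 'n \<Rightarrow> real ^ 'n" where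
  "log_map z = (\<chi> i. ln (norm (z $ i)))"

definition log_image :: "(nat ^ 'n \<Rightarrow> complex) \<Rightarrow> (real ^ 'n) set" where
  "log_image c = log_map ` (domain_of_convergence c \<inter> {z. \<forall>i. z $ i \<noteq> 0})"

(* The logarithm of a nonnegative real, with log 0 = -\<infinity>. *)
definition elog :: "real \<Rightarrow> ereal" where
  "elog x = (if x = 0 then -\<infinity> else ereal (ln x))"

(* The supremum is antitone in k, so the limit always exists in ereal. *)
definition multi_limsup :: "(nat ^ 'n \<Rightarrow> ereal) \<Rightarrow> ereal" where
  "multi_limsup a = lim (\<lambda>k. SUP J\<in>{J. multideg J \<ge> k}. a J)"

end

theory Submission imports Defs begin

text \<open>
  For \<open>c J \<noteq> 0\<close> the modulus of the term \<open>c J * multipow z J\<close> at a point \<open>z\<close> with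
  \<open>log_map z = s\<close> is the exponential of \<open>ln (norm (c J)) + J \<bullet> s\<close>, and the expression under
  the upper limit is this exponent divided by \<open>|J|\<close>. Hence the upper limit is negative iff,
  for some \<open>e > 0\<close>, the exponent is at most \<open>- e * |J|\<close> for all \<open>J\<close> of large degree with
  \<open>c J \<noteq> 0\<close>, i.e. iff the terms are eventually dominated by \<open>exp (- e) ^ |J|\<close>. This is the
  predicate \<open>decaying\<close> (lemma \<open>multi_limsup_less_0_iff_decaying\<close>).

  In this form both inclusions are short. If \<open>s\<close> is decaying with rate \<open>e\<close>, all its coordinates
  may be raised by \<open>e / 2\<close> at the cost of halving the rate (\<open>decaying_shift\<close>); the convergent
  majorant \<open>\<Sum>J. q ^ |J|\<close> with \<open>q < 1\<close> then gives convergence on an open polydisc around \<open>0\<close> that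
  contains the points over \<open>s\<close> (\<open>decaying_imp_log_image\<close>). Conversely, if \<open>z\<close> over \<open>s\<close> is interior
  to the convergence set, the series still converges at \<open>r *\<^sub>R z\<close> for some \<open>r > 1\<close>; its terms
  there are bounded, so those at \<open>z\<close> decay like \<open>r powr (- |J|)\<close> (\<open>log_image_imp_decaying\<close>).

  The set of decaying points is open by \<open>decaying_shift\<close>, and convex because the exponent is an
  affine function of \<open>s\<close> (\<open>convex_decaying\<close>).
\<close>

section \<open>Multi-indices and geometric series\<close>

definition multidot :: "nat ^ 'n \<Rightarrow> real ^ 'n \<Rightarrow> real" where
  "multidot J s = (\<Sum>i\<in>UNIV. real (J $ i) * s $ i)"

lemma real_multideg: "real (multideg J) = (\<Sum>i\<in>UNIV. real (J $ i))"
  by (simp add: multideg_def)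

lemma multidot_affine:
  "multidot J (u *\<^sub>R s + v *\<^sub>R t) = u * multidot J s + v * multidot J t"
  by (simp add: multidot_def sum.distrib sum_distrib_left algebra_simps)

lemma multidot_le_shift:
  assumes "\<And>i. t $ i \<le> s $ i + d"
  shows "multidot J t \<le> multidot J s + d * real (multideg J)"
proof -
  have "multidot J t \<le> (\<Sum>i\<in>UNIV. real (J $ i) * (s $ i + d))"
    unfolding multidot_def by (intro sum_mono mult_left_mono assms) auto
  also have "\<dots> = multidot J s + d * real (multideg J)"
    by (simp add: multidot_def real_multideg sum.distrib sum_distrib_left algebra_simps)
  finally show ?thesis .
qed

lemma finite_multideg_less: "finite {J :: nat ^ 'n. multideg J < k}"
proof (rule finite_subset)
  show "{J :: nat ^ 'n. multideg J < k} \<subseteq> vec_lambda ` (PiE UNIV (\<lambda>_. {..<k}))"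
  proof
    fix J :: "nat ^ 'n"
    assume "J \<in> {J. multideg J < k}"
    moreover have "J $ i \<le> multideg J" for i
      unfolding multideg_def by (rule member_le_sum) auto
    ultimately have "vec_nth J \<in> PiE UNIV (\<lambda>_. {..<k})"
      by (auto intro: le_less_trans)
    moreover have "J = vec_lambda (vec_nth J)"
      by simp
    ultimately show "J \<in> vec_lambda ` (PiE UNIV (\<lambda>_. {..<k}))"
      by blast
  qed
  show "finite (vec_lambda ` (PiE UNIV (\<lambda>_. {..<k})) :: (nat ^ 'n) set)"
    by (intro finite_imageI finite_PiE) auto
qed

text \<open>The series is a product of one-variable geometric series, one factor for each coordinate.\<close>
lemma summable_on_power_multideg:
  fixes q :: real
  assumes "0 \<le> q" "q < 1"
  shows "(\<lambda>J :: nat ^ 'n. q ^ multideg J) summable_on UNIV"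
proof -
  have "summable (\<lambda>n. norm (q ^ n))"
    using assms by (simp add: summable_geometric)
  then have "Infinite_Set_Sum.abs_summable_on (\<lambda>n. q ^ n) (UNIV :: nat set)"
    by (simp add: abs_summable_on_nat_iff')
  then have "Infinite_Set_Sum.abs_summable_on (\<lambda>g. \<Prod>i\<in>UNIV. q ^ g i)
      (PiE (UNIV :: 'n set) (\<lambda>_. UNIV :: nat set))"
    by (intro abs_summable_on_prod_PiE) auto
  then have "(\<lambda>g :: 'n \<Rightarrow> nat. \<Prod>i\<in>UNIV. q ^ g i) summable_on UNIV"
    using abs_summable_equivalent abs_summable_summable by fastforce
  moreover have "range vec_nth = (UNIV :: ('n \<Rightarrow> nat) set)"
    by (rule surjI [of _ vec_lambda]) (simp add: vec_lambda_inverse)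
  ultimately have "((\<lambda>g :: 'n \<Rightarrow> nat. \<Prod>i\<in>UNIV. q ^ g i) \<circ> vec_nth) summable_on (UNIV :: (nat ^ 'n) set)"
    by (subst summable_on_reindex [symmetric]) (auto simp: inj_on_def vec_nth_inject)
  then show ?thesis
    by (simp add: comp_def multideg_def power_sum)
qed

lemma norm_multipow_le:
  assumes "\<And>i. norm (z $ i) \<le> exp (t $ i)"
  shows "norm (multipow z J) \<le> exp (multidot J t)"
proof -
  have "norm (multipow z J) = (\<Prod>i\<in>UNIV. norm (z $ i) ^ (J $ i))"
    by (simp add: multipow_def prod_norm [symmetric] norm_power)
  also have "\<dots> \<le> (\<Prod>i\<in>UNIV. exp (t $ i) ^ (J $ i))"
    by (intro prod_mono conjI power_mono assms) auto
  also have "\<dots> = exp (multidot J t)"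
    by (simp add: multidot_def exp_sum exp_of_nat_mult)
  finally show ?thesis .
qed

lemma norm_multipow_eq:
  assumes "\<And>i. z $ i \<noteq> 0"
  shows "norm (multipow z J) = exp (multidot J (log_map z))"
  using assms
  by (simp add: multipow_def multidot_def log_map_def exp_sum exp_of_nat_mult prod_norm [symmetric] norm_power)

lemma multipow_scaleR:
  "multipow (r *\<^sub>R z) J = of_real r ^ multideg J * multipow z J"
proof -
  have "(r *\<^sub>R z) $ i = of_real r * z $ i" for i
    by (subst vector_scaleR_component) (rule scaleR_conv_of_real)
  then show ?thesis
    by (simp add: multipow_def multideg_def power_sum prod.distrib power_mult_distrib)
qed

section \<open>Decay\<close>

text \<open>
  The restriction to \<open>c J \<noteq> 0\<close> plays the part of \<open>log 0 = -\<infinity>\<close>. Multiplying the inequality out by the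
  degree makes it affine in \<open>s\<close>.
\<close>
definition decaying :: "(nat ^ 'n \<Rightarrow> complex) \<Rightarrow> real ^ 'n \<Rightarrow> bool" where
  "decaying c s \<longleftrightarrow> (\<exists>e>0. \<exists>k. \<forall>J. k \<le> multideg J \<longrightarrow> c J \<noteq> 0 \<longrightarrow>
     ln (norm (c J)) + multidot J s \<le> - e * real (multideg J))"

text \<open>
  The suprema of the tails decrease, so their limit is their infimum; it is negative iff a single
  one of them is, and a negative extended real lies below some negative real.
\<close>
lemma multi_limsup_less_0_iff:
  "multi_limsup a < 0 \<longleftrightarrow> (\<exists>e>0. \<exists>k. \<forall>J. k \<le> multideg J \<longrightarrow> a J \<le> ereal (- e))"
proof -
  define S where "S = (\<lambda>k. SUP J\<in>{J. multideg J \<ge> k}. a J)"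
  have "decseq S"
    unfolding S_def by (intro decseq_SucI SUP_subset_mono) auto
  then have "multi_limsup a = (INF k. S k)"
    unfolding multi_limsup_def S_def by (intro limI LIMSEQ_INF)
  then have "multi_limsup a < 0 \<longleftrightarrow> (\<exists>k. S k < 0)"
    by (simp add: INF_less_iff)
  also have "\<dots> \<longleftrightarrow> (\<exists>k. \<exists>e>0. S k \<le> ereal (- e))"
  proof (intro ex_cong1 iffI)
    fix k
    assume "S k < 0"
    then obtain x where "S k < ereal x" "x < 0"
      using ereal_dense2 [of "S k" 0] by auto
    then show "\<exists>e>0. S k \<le> ereal (- e)"
      by (intro exI [of _ "- x"]) auto
  next
    fix k
    assume "\<exists>e>0. S k \<le> ereal (- e)"
    then show "S k < 0"
      by (auto elim!: le_less_trans)
  qed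
  also have "\<dots> \<longleftrightarrow> (\<exists>e>0. \<exists>k. \<forall>J. k \<le> multideg J \<longrightarrow> a J \<le> ereal (- e))"
    by (auto simp: S_def SUP_le_iff)
  finally show ?thesis .
qed

lemma limsup_term_le_iff:
  assumes "0 < multideg J"
  shows "ereal (multidot J s / real (multideg J)) + elog (norm (c J)) / ereal (real (multideg J)) \<le> ereal (- e)
    \<longleftrightarrow> (c J \<noteq> 0 \<longrightarrow> ln (norm (c J)) + multidot J s \<le> - e * real (multideg J))"
proof (cases "c J = 0")
  case True
  then show ?thesis
    using assms by (simp add: elog_def divide_ereal_def)
next
  case False
  then show ?thesis
    using assms by (simp add: elog_def add_divide_distrib [symmetric] divide_le_eq add.commute)
qed

lemma multi_limsup_less_0_iff_decaying:
  "multi_limsup (\<lambda>J. ereal (multidot J s / real (multideg J))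
      + elog (norm (c J)) / ereal (real (multideg J))) < 0 \<longleftrightarrow> decaying c s"
    (is "multi_limsup ?a < 0 \<longleftrightarrow> _")
proof -
  (* The term of degree zero is excluded by passing from k to max 1 k. *)
  have "(\<exists>k. \<forall>J. k \<le> multideg J \<longrightarrow> P J) \<longleftrightarrow> (\<exists>k. \<forall>J. k \<le> multideg J \<longrightarrow> 0 < multideg J \<longrightarrow> P J)"
    for P :: "nat ^ 'a \<Rightarrow> bool"
  proof
    assume "\<exists>k. \<forall>J. k \<le> multideg J \<longrightarrow> 0 < multideg J \<longrightarrow> P J"
    then obtain k where "\<forall>J. k \<le> multideg J \<longrightarrow> 0 < multideg J \<longrightarrow> P J" ..
    then show "\<exists>k. \<forall>J. k \<le> multideg J \<longrightarrow> P J"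
      by (intro exI [of _ "max 1 k"]) auto
  qed blast
  note eventually_pos = this
  have "multi_limsup ?a < 0 \<longleftrightarrow>
      (\<exists>e>0. \<exists>k. \<forall>J. k \<le> multideg J \<longrightarrow> 0 < multideg J \<longrightarrow> ?a J \<le> ereal (- e))"
    unfolding multi_limsup_less_0_iff by (subst eventually_pos) (rule refl)
  also have "\<dots> \<longleftrightarrow> (\<exists>e>0. \<exists>k. \<forall>J. k \<le> multideg J \<longrightarrow> 0 < multideg J \<longrightarrow>
      (c J \<noteq> 0 \<longrightarrow> ln (norm (c J)) + multidot J s \<le> - e * real (multideg J)))"
    by (simp only: limsup_term_le_iff cong: imp_cong)
  also have "\<dots> \<longleftrightarrow> decaying c s"
    unfolding decaying_def by (subst (2) eventually_pos) (rule refl)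
  finally show ?thesis .
qed

text \<open>
  For \<open>u + v = 1\<close> the exponent at \<open>u *\<^sub>R s + v *\<^sub>R t\<close> is the same convex combination of the exponents
  at \<open>s\<close> and \<open>t\<close>, so the smaller of the two rates serves for it.
\<close>
lemma convex_decaying: "convex {s. decaying c s}"
proof (rule convexI)
  fix s t :: "real ^ 'a" and u v :: real
  assume "s \<in> {s. decaying c s}" "t \<in> {s. decaying c s}" and uv: "0 \<le> u" "0 \<le> v" "u + v = 1"
  then obtain d k e l where d: "0 < d" and k: "\<And>J. k \<le> multideg J \<Longrightarrow> c J \<noteq> 0 \<Longrightarrow>
        ln (norm (c J)) + multidot J s \<le> - d * real (multideg J)"
    and e: "0 < e" and l: "\<And>J. l \<le> multideg J \<Longrightarrow> c J \<noteq> 0 \<Longrightarrow>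
        ln (norm (c J)) + multidot J t \<le> - e * real (multideg J)"
    unfolding decaying_def by auto
  have "ln (norm (c J)) + multidot J (u *\<^sub>R s + v *\<^sub>R t) \<le> - min d e * real (multideg J)"
    if J: "max k l \<le> multideg J" "c J \<noteq> 0" for J
  proof -
    have m: "- d * real (multideg J) \<le> - min d e * real (multideg J)"
      "- e * real (multideg J) \<le> - min d e * real (multideg J)"
      by (intro mult_right_mono; simp)+
    have "ln (norm (c J)) + multidot J (u *\<^sub>R s + v *\<^sub>R t) =
        (u + v) * ln (norm (c J)) + (u * multidot J s + v * multidot J t)"
      by (simp add: uv multidot_affine)
    also have "\<dots> = u * (ln (norm (c J)) + multidot J s) + v * (ln (norm (c J)) + multidot J t)"
      by (simp add: algebra_simps)
    also have "\<dots> \<le> - min d e * real (multideg J)"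
      using J by (intro convex_bound_le uv order_trans [OF k m(1)] order_trans [OF l m(2)]) auto
    finally show ?thesis .
  qed
  moreover have "0 < min d e" using d e by simp
  ultimately show "u *\<^sub>R s + v *\<^sub>R t \<in> {s. decaying c s}"
    unfolding decaying_def by blast
qed

text \<open>
  The slack \<open>e * |J|\<close> absorbs a shift of the coordinates by \<open>e / 2\<close>, which changes the exponent by at
  most \<open>e / 2 * |J|\<close>. The bound on \<open>t\<close> is one-sided because lowering coordinates only makes the terms
  smaller; this yields both a neighbourhood of \<open>s\<close> and a polydisc of larger radii.
\<close>
lemma decaying_shift:
  fixes s :: "real ^ 'n"
  assumes "decaying c s"
  obtains d where "0 < d" "\<And>t. (\<And>i. t $ i \<le> s $ i + d) \<Longrightarrow> decaying c t"
proof -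
  obtain e k where e: "0 < e" and k: "\<And>J. k \<le> multideg J \<Longrightarrow> c J \<noteq> 0 \<Longrightarrow>
      ln (norm (c J)) + multidot J s \<le> - e * real (multideg J)"
    using assms unfolding decaying_def by auto
  show thesis
  proof (rule that [of "e / 2"])
    fix t :: "real ^ 'n"
    assume t: "\<And>i. t $ i \<le> s $ i + e / 2"
    have "ln (norm (c J)) + multidot J t \<le> - (e / 2) * real (multideg J)"
      if "k \<le> multideg J" "c J \<noteq> 0" for J
      using k [OF that] multidot_le_shift [OF t, of J] by (simp add: field_simps)
    with e show "decaying c t"
      unfolding decaying_def by (meson half_gt_zero)
  qed (use e in simp)
qed

lemma open_decaying: "open {s. decaying c s}"
  unfolding open_contains_ball
proof
  fix s assume "s \<in> {s. decaying c s}"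
  then obtain d where d: "0 < d" "\<And>t. (\<And>i. t $ i \<le> s $ i + d) \<Longrightarrow> decaying c t"
    using decaying_shift by blast
  have "t $ i \<le> s $ i + d" if "t \<in> ball s d" for t i
  proof -
    have "t $ i - s $ i \<le> norm (t - s)"
      using component_le_norm_cart [of "t - s" i] by simp
    also have "\<dots> < d"
      using that by (simp add: dist_norm norm_minus_commute)
    finally show ?thesis by simp
  qed
  with d show "\<exists>d>0. ball s d \<subseteq> {s. decaying c s}"
    by blast
qed

section \<open>The logarithmic image\<close>

lemma decaying_imp_polydisc:
  assumes "decaying c t" and z: "\<And>i. norm (z $ i) \<le> exp (t $ i)"
  shows "z \<in> convergence_set c"
proof -
  obtain e k where e: "0 < e" and k: "\<And>J. k \<le> multideg J \<Longrightarrow> c J \<noteq> 0 \<Longrightarrow>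
      ln (norm (c J)) + multidot J t \<le> - e * real (multideg J)"
    using assms(1) unfolding decaying_def by auto
  let ?f = "\<lambda>J. norm (c J * multipow z J)"
  have le: "?f J \<le> exp (- e) ^ multideg J" if "k \<le> multideg J" for J
  proof (cases "c J = 0")
    case False
    have "?f J \<le> norm (c J) * exp (multidot J t)"
      by (simp add: norm_mult mult_left_mono norm_multipow_le z)
    also have "\<dots> = exp (ln (norm (c J)) + multidot J t)"
      using False by (simp add: exp_add)
    also have "\<dots> \<le> exp (- e * real (multideg J))"
      using k [OF that False] by simp
    also have "\<dots> = exp (- e) ^ multideg J"
      by (simp add: exp_of_nat_mult [symmetric] mult.commute)
    finally show ?thesis .
  qed simp
  have "?f summable_on {J. k \<le> multideg J}"
  proof (rule summable_on_comparison_test)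
    have "(\<lambda>J :: nat ^ 'a. exp (- e) ^ multideg J) summable_on UNIV"
      using e by (intro summable_on_power_multideg) auto
    then show "(\<lambda>J :: nat ^ 'a. exp (- e) ^ multideg J) summable_on {J. k \<le> multideg J}"
      by (rule summable_on_subset_banach) simp
  qed (use le in auto)
  moreover have "?f summable_on {J. multideg J < k}"
    by (intro summable_on_finite finite_multideg_less)
  ultimately have "?f summable_on {J. k \<le> multideg J} \<union> {J. multideg J < k}"
    by (intro summable_on_Un_disjoint) auto
  moreover have "{J. k \<le> multideg J} \<union> {J. multideg J < k} = (UNIV :: (nat ^ 'a) set)"
    by auto
  ultimately show ?thesis
    unfolding convergence_set_def by simp
qed

text \<open>
  Convergence at the points over \<open>s\<close> alone would not suffice: raising all coordinates of \<open>s\<close> by \<open>d\<close>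
  gives an open polydisc of convergence with such a point inside.
\<close>
lemma decaying_imp_log_image:
  fixes s :: "real ^ 'n"
  assumes "decaying c s"
  shows "s \<in> log_image c"
proof -
  obtain d where d: "0 < d" "\<And>t. (\<And>i. t $ i \<le> s $ i + d) \<Longrightarrow> decaying c t"
    using decaying_shift [OF assms] by blast
  let ?t = "\<chi> i. s $ i + d"
  let ?P = "{z :: complex ^ 'n. \<forall>i. norm (z $ i) < exp (?t $ i)}"
  let ?z = "\<chi> i. complex_of_real (exp (s $ i))"
  have "decaying c ?t"
    by (rule d(2)) simp
  then have "?P \<subseteq> convergence_set c"
    by (blast intro: decaying_imp_polydisc less_imp_le)
  moreover have "open ?P"
    unfolding Collect_all_eq by (intro open_INT ballI finite open_Collect_less continuous_intros)
  moreover have "?z \<in> ?P"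
    using d(1) by simp
  ultimately have "?z \<in> domain_of_convergence c"
    unfolding domain_of_convergence_def by (meson interior_maximal subsetD)
  moreover have "?z \<in> {z. \<forall>i. z $ i \<noteq> 0}"
    by simp
  moreover have "s = log_map ?z"
    by (simp add: log_map_def vec_eq_iff)
  ultimately show ?thesis
    unfolding log_image_def by (intro image_eqI IntI)
qed

text \<open>
  Being interior allows \<open>z\<close> to be dilated by a factor \<open>r > 1\<close>. If \<open>M\<close> bounds the terms at \<open>r *\<^sub>R z\<close>, the
  exponent at \<open>s\<close> is at most \<open>ln M - |J| * ln r\<close>, and half of \<open>|J| * ln r\<close> eventually exceeds \<open>ln M\<close>.
\<close>
lemma log_image_imp_decaying:
  assumes "s \<in> log_image c"
  shows "decaying c s"
proof -
  obtain z where z: "z \<in> interior (convergence_set c)" "\<And>i. z $ i \<noteq> 0" and s: "s = log_map z"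
    using assms unfolding log_image_def domain_of_convergence_def by auto
  have "\<exists>r>1. r *\<^sub>R z \<in> convergence_set c"
  proof -
    have "((\<lambda>r. r *\<^sub>R z) \<longlongrightarrow> 1 *\<^sub>R z) (at_right (1 :: real))"
      by (intro tendsto_intros)
    then have "eventually (\<lambda>r. r *\<^sub>R z \<in> interior (convergence_set c)) (at_right (1 :: real))"
      using z(1) by (intro topological_tendstoD) auto
    then have "eventually (\<lambda>r. r > 1 \<and> r *\<^sub>R z \<in> convergence_set c) (at_right (1 :: real))"
      using eventually_at_right_less [of 1] interior_subset by (auto elim!: eventually_elim2)
    then show ?thesis
      using eventually_happens' [OF trivial_limit_at_right_real] by blast
  qed
  then obtain r where r: "1 < r" "r *\<^sub>R z \<in> convergence_set c" by blast
  let ?f = "\<lambda>J. norm (c J * multipow (r *\<^sub>R z) J)"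
  have f: "?f J = norm (c J) * r ^ multideg J * exp (multidot J s)" for J
    using r(1) by (simp add: norm_mult multipow_scaleR norm_power norm_multipow_eq z(2) s)
  have sm: "?f summable_on UNIV"
    using r(2) by (simp add: convergence_set_def)
  define M where "M = max 1 (infsum ?f UNIV)"
  have M: "?f J \<le> M" for J
  proof -
    have "?f J = infsum ?f {J}" by simp
    also have "\<dots> \<le> infsum ?f UNIV"
      using sm by (intro infsum_mono_neutral) auto
    finally show ?thesis by (simp add: M_def)
  qed
  define k where "k = nat \<lceil>2 * ln M / ln r\<rceil>"
  have "ln (norm (c J)) + multidot J s \<le> - (ln r / 2) * real (multideg J)"
    if "k \<le> multideg J" "c J \<noteq> 0" for J
  proof -
    have "ln (norm (c J)) + real (multideg J) * ln r + multidot J s = ln (?f J)"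
      unfolding f using r(1) that(2) by (simp add: ln_mult ln_realpow)
    also have "\<dots> \<le> ln M"
    proof -
      have "0 < ?f J" unfolding f using r(1) that(2) by simp
      with M [of J] show ?thesis by (intro ln_mono) auto
    qed
    also have "ln M \<le> ln r / 2 * real (multideg J)"
    proof -
      have "2 * ln M / ln r \<le> real (multideg J)"
        using that(1) unfolding k_def by linarith
      then show ?thesis
        using r(1) by (simp add: field_simps)
    qed
    finally show ?thesis by (simp add: field_simps)
  qed
  moreover have "0 < ln r / 2" using r(1) by simp
  ultimately show ?thesis
    unfolding decaying_def by blast
qed

theorem mainTheorem2:
  fixes c :: "nat ^ 'n \<Rightarrow> complex"
  shows "open (log_image c) \<and> convex (log_image c) \<and>
    log_image c = {s :: real ^ 'n.
      multi_limsup (\<lambda>J. ereal ((\<Sum>i\<in>UNIV. real (J $ i) * s $ i) / real (multideg J))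
                       + elog (norm (c J)) / ereal (real (multideg J))) < 0}"
proof -
  have "log_image c = {s. decaying c s}"
    using decaying_imp_log_image log_image_imp_decaying by blast
  then show ?thesis
    using open_decaying [of c] convex_decaying [of c]
    by (simp del: Collect_const add: multi_limsup_less_0_iff_decaying [unfolded multidot_def])
qed

end
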